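(* Let $x,y,\nu,p\in\mathbb{C}$ with $\Re(p)>0$. Then $$B_{\nu}(x,y;p)= \sum_{n=0}^\infty B_{\nu}(x+n,y+1;p).$$
   Context: $K_\mu(z)$ denotes the modified Bessel function of the second kind of order $\mu$. For $x,y,\nu\in\mathbb{C}$ and $\Re(p)>0$ the extended Beta function is $$B_{\nu}(x,y;p):= \sqrt{\frac{2p}{\pi}}\int_{0}^{1} t^{x-\frac{3}{2}}(1-t)^{y-\frac{3}{2}}\, K_{\nu+\frac{1}{2}}\left(\frac{p}{t(1-t)}\right)dt .$$ Square roots take principal values. *)

theory Defs
  imports "HOL-Analysis.Analysis"
begin

text \<open>
  Modified Bessel function of the first kind, principal branch:
  \<open>I\<^sub>\<mu>(z) = (z/2)\<^sup>\<mu> \<Sum>\<^sub>k (z\<^sup>2/4)\<^sup>k / (k! \<Gamma>(\<mu>+k+1))\<close>; terms at the poles of the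
  Gamma function vanish, because \<^const>\<open>rGamma\<close> is zero there.
\<close>
definition bessel_I :: "complex \<Rightarrow> complex \<Rightarrow> complex" where
  "bessel_I \<mu> z =
     (z / 2) powr \<mu> * (\<Sum>k. (z\<^sup>2 / 4) ^ k * rGamma (\<mu> + of_nat k + 1) / fact k)"

text \<open>
  Modified Bessel function of the second kind. The usual quotient is
  undefined at integer order, where the function is its limit in the order.
\<close>
definition bessel_K :: "complex \<Rightarrow> complex \<Rightarrow> complex" where
  "bessel_K \<mu> z =
     (let Q = (\<lambda>m. of_real pi / 2 * (bessel_I (- m) z - bessel_I m z) / sin (m * of_real pi))
      in if \<mu> \<in> \<int> then Lim (at \<mu>) Q else Q \<mu>)"

definition ext_Beta :: "complex \<Rightarrow> complex \<Rightarrow> complex \<Rightarrow> complex \<Rightarrow> complex" where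
  "ext_Beta \<nu> x y p =
     csqrt (2 * p / of_real pi) *
     (LINT t:{0<..<1}|lborel.
        of_real t powr (x - 3 / 2) * of_real (1 - t) powr (y - 3 / 2) *
        bessel_K (\<nu> + 1 / 2) (p / of_real (t * (1 - t))))"

end

theory Submission
  imports Defs "HOL-Probability.Sinc_Integral"
begin

text \<open>
  On \<open>0 < t < 1\<close> the geometric series \<open>\<Sum>\<^sub>n t\<^sup>n (1 - t) = 1\<close> turns the integrands of the summands into
  the integrand on the left, with partial sums dominated by it, so everything rests on that integrand being
  integrable. This needs the decay of \<open>K\<^sub>\<mu>(z)\<close> for \<open>z \<rightarrow> \<infinity>\<close> in the right half plane, which is read off from
  \<open>2 K\<^sub>\<mu>(z) = J\<^sub>\<mu>(z)\<close> with \<open>J\<^sub>\<mu>(z) = \<integral> exp (\<mu> t - z cosh t) dt\<close> over the real line.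

  To obtain this representation from the definition by power series, one shows that
  \<open>z/2 (J\<^sub>a I\<^sub>a\<^sub>+\<^sub>1 + J\<^sub>a\<^sub>+\<^sub>1 I\<^sub>a) = 1\<close>: the left-hand side has derivative zero in \<open>z\<close>, it tends to
  \<open>\<Gamma>(a+1) / \<Gamma>(a+1)\<close> for \<open>z \<rightarrow> 0+\<close> if \<open>Re a > 0\<close>, and by the three-term recurrences it has period 1 in \<open>a\<close>.
  The instances \<open>a = \<mu> - 1\<close> and \<open>a = -\<mu>\<close> are linear equations for \<open>J\<^sub>\<mu>\<close> and \<open>J\<^bsub>\<mu>-1\<^esub>\<close> whose determinant is
  \<open>sin (\<pi>\<mu>) / \<pi>\<close>. Integer orders follow because \<open>J\<^sub>\<mu>\<close> is continuous in \<open>\<mu>\<close>.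
\<close>

section \<open>Limits and derivatives under the integral sign\<close>

text \<open>In a first countable space the filter \<open>at x0 within S\<close> is tested by
  sequences in \<open>S - {x0}\<close>, and along each of these the sequential dominated convergence
  theorem applies.\<close>

lemma tendsto_integral_dominated_within:
  fixes f :: "'a::first_countable_topology \<Rightarrow> 'b \<Rightarrow> 'c::{banach,second_countable_topology}"
  assumes "\<And>x. x \<in> S - {x0} \<Longrightarrow> f x \<in> borel_measurable M" "g \<in> borel_measurable M"
    and "integrable M h"
    and "\<And>x t. x \<in> S - {x0} \<Longrightarrow> norm (f x t) \<le> h t"
    and "\<And>t. ((\<lambda>x. f x t) \<longlongrightarrow> g t) (at x0 within S)"
  shows "((\<lambda>x. integral\<^sup>L M (f x)) \<longlongrightarrow> integral\<^sup>L M g) (at x0 within S)"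
  unfolding tendsto_at_iff_sequentially comp_def
proof (intro allI impI)
  fix X assume X: "\<forall>i. X i \<in> S - {x0}" "X \<longlonglongrightarrow> x0"
  show "(\<lambda>i. integral\<^sup>L M (f (X i))) \<longlonglongrightarrow> integral\<^sup>L M g"
  proof (rule integral_dominated_convergence)
    show "AE t in M. (\<lambda>i. f (X i) t) \<longlonglongrightarrow> g t"
      using assms(5) X unfolding tendsto_at_iff_sequentially comp_def by blast
  qed (use assms X in auto)
qed

text \<open>By the mean value inequality on the convex set \<open>S\<close>, the bound
  \<open>h t\<close> for the derivative also bounds the difference quotients, which therefore
  converge under the integral.\<close>

lemma has_field_derivative_integral:
  fixes f f' :: "complex \<Rightarrow> 'b \<Rightarrow> complex"
  assumes S: "open S" "convex S" "z0 \<in> S"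
    and int: "\<And>z. z \<in> S \<Longrightarrow> integrable M (f z)"
    and meas: "f' z0 \<in> borel_measurable M"
    and h: "integrable M h"
    and bound: "\<And>z t. z \<in> S \<Longrightarrow> norm (f' z t) \<le> h t"
    and deriv: "\<And>z t. z \<in> S \<Longrightarrow> ((\<lambda>z. f z t) has_field_derivative f' z t) (at z)"
  shows "((\<lambda>z. integral\<^sup>L M (f z)) has_field_derivative integral\<^sup>L M (f' z0)) (at z0)"
proof -
  have "((\<lambda>z. integral\<^sup>L M (\<lambda>t. (f z t - f z0 t) / (z - z0))) \<longlongrightarrow> integral\<^sup>L M (f' z0)) (at z0 within S)"
  proof (rule tendsto_integral_dominated_within[OF _ meas h])
    show "(\<lambda>t. (f z t - f z0 t) / (z - z0)) \<in> borel_measurable M" if "z \<in> S - {z0}" for z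
      using int[of z] int[of z0] that S by auto
    show "norm ((f z t - f z0 t) / (z - z0)) \<le> h t" if "z \<in> S - {z0}" for z t
    proof -
      have "norm (f z t - f z0 t) \<le> h t * norm (z - z0)"
        by (rule field_differentiable_bound[OF \<open>convex S\<close>])
           (use that S bound has_field_derivative_at_within[OF deriv] in auto)
      with that show ?thesis
        by (simp add: norm_divide field_simps)
    qed
    show "((\<lambda>z. (f z t - f z0 t) / (z - z0)) \<longlongrightarrow> f' z0 t) (at z0 within S)" for t
      using has_field_derivative_at_within[OF deriv[OF \<open>z0 \<in> S\<close>], of t S]
      by (simp add: has_field_derivative_iff)
  qed
  moreover have "integral\<^sup>L M (\<lambda>t. (f z t - f z0 t) / (z - z0)) =
      (integral\<^sup>L M (f z) - integral\<^sup>L M (f z0)) / (z - z0)" if "z \<in> S" for z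
    using int[OF that] int[of z0] S by simp
  ultimately have "((\<lambda>z. (integral\<^sup>L M (f z) - integral\<^sup>L M (f z0)) / (z - z0)) \<longlongrightarrow> integral\<^sup>L M (f' z0)) (at z0 within S)"
    by (elim Lim_transform_within[OF _ zero_less_one]) auto
  thus ?thesis
    using S by (simp add: has_field_derivative_iff at_within_open[of z0 S])
qed

section \<open>Majorants for the kernel\<close>

lemma integrable_exp_neg_abs:
  fixes c :: real
  assumes "c > 0"
  shows "integrable lborel (\<lambda>t. exp (- (c * \<bar>t\<bar>)))"
proof -
  define g where "g = (\<lambda>t::real. indicator {0<..} t *\<^sub>R exp (- (t * c)))"
  have g: "integrable lborel g"
    using integrable_I0i_exp_mscale[OF assms] by (simp add: g_def set_integrable_def)
  have "integrable lborel (\<lambda>t. g (0 + (-1) * t))"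
    by (rule lborel_integrable_real_affine[OF g]) simp
  with g have "integrable lborel (\<lambda>t. g t + g (-t))"
    by (intro Bochner_Integration.integrable_add) auto
  \<comment> \<open>At \<open>t = 0\<close> both half-line functions vanish while the exponential is
    1, hence equality only almost everywhere.\<close>
  moreover have "AE t in lborel. g t + g (-t) = exp (- (c * \<bar>t\<bar>))"
    using AE_lborel_singleton[of 0]
    by eventually_elim (auto simp: g_def indicator_def abs_if mult.commute)
  ultimately show ?thesis
    using g by (subst (asm) integrable_cong_AE) (auto simp: measurable_lborel2)
qed

lemma cosh_ge_quarter_square: "cosh (t::real) \<ge> t\<^sup>2 / 4"
proof -
  have *: "exp u \<ge> 1 + u + u\<^sup>2 / 2" if "u \<ge> 0" for u :: real
    using exp_lower_Taylor_quadratic[OF that] by (simp add: field_simps)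
  have "cosh \<bar>t\<bar> \<ge> t\<^sup>2 / 4"
    using *[of "\<bar>t\<bar>"] exp_ge_add_one_self[of "- \<bar>t\<bar>"]
    by (simp add: cosh_field_def power2_eq_square)
  thus ?thesis by simp
qed

text \<open>Since \<open>cosh t\<close> is at least t^2/4, completing the square applies: the
  maximum of (A + 1) s - c s^2/4 over real s is (A + 1)^2/c. Taking A + 1 in place of A leaves the
  decaying term -|t|.\<close>

lemma abs_minus_cosh_le:
  fixes A c t :: real
  assumes "c > 0"
  shows "A * \<bar>t\<bar> - c * cosh t \<le> (A + 1)\<^sup>2 / c - \<bar>t\<bar>"
proof -
  have "0 \<le> (c * \<bar>t\<bar> / 2 - (A + 1))\<^sup>2 / c" using assms by simp
  also have "\<dots> = c * t\<^sup>2 / 4 - (A + 1) * \<bar>t\<bar> + (A + 1)\<^sup>2 / c"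
    using assms by (simp add: power2_eq_square field_simps)
  finally have "(A + 1) * \<bar>t\<bar> - (A + 1)\<^sup>2 / c \<le> c * (t\<^sup>2 / 4)" by simp
  also have "\<dots> \<le> c * cosh t"
    using assms cosh_ge_quarter_square[of t] by (intro mult_left_mono) auto
  finally show ?thesis by (simp add: algebra_simps)
qed

lemma integrable_exp_abs_minus_cosh:
  fixes A c :: real
  assumes "c > 0"
  shows "integrable lborel (\<lambda>t. exp (A * \<bar>t\<bar> - c * cosh t))"
proof (rule Bochner_Integration.integrable_bound)
  show "integrable lborel (\<lambda>t. exp ((A + 1)\<^sup>2 / c) * exp (- (1 * \<bar>t::real\<bar>)))"
    by (intro integrable_mult_right integrable_exp_neg_abs) simp
  show "AE t in lborel. norm (exp (A * \<bar>t\<bar> - c * cosh t)) \<le>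
      norm (exp ((A + 1)\<^sup>2 / c) * exp (- (1 * \<bar>t::real\<bar>)))"
    using abs_minus_cosh_le[OF assms] by (simp flip: exp_add)
qed (simp add: cosh_field_def)

section \<open>The integral J and its recurrences\<close>

definition bessel_kernel :: "complex \<Rightarrow> complex \<Rightarrow> real \<Rightarrow> complex" where
  "bessel_kernel a z t = exp (a * of_real t - z * of_real (cosh t))"

text \<open>This is J of the overview. Integrating over the whole line makes reflection and
  translation of \<open>t\<close> available.\<close>

definition bessel_integral :: "complex \<Rightarrow> complex \<Rightarrow> complex" where
  "bessel_integral a z = integral\<^sup>L lborel (bessel_kernel a z)"

lemma continuous_on_bessel_kernel [continuous_intros]: "continuous_on S (bessel_kernel a z)"
  unfolding bessel_kernel_def cosh_field_def by (intro continuous_intros) auto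

lemma measurable_bessel_kernel [measurable]: "bessel_kernel a z \<in> borel_measurable borel"
  by (intro borel_measurable_continuous_onI continuous_intros)

text \<open>The bound is uniform in the order and the argument, so that it can serve as majorant
  both for the derivative in \<open>z\<close> and for continuity in \<open>a\<close>.\<close>

lemma norm_bessel_kernel_le:
  assumes "\<bar>Re a\<bar> \<le> A" "c \<le> Re z"
  shows "norm (bessel_kernel a z t) \<le> exp (A * \<bar>t\<bar> - c * cosh t)"
proof -
  have "Re a * t \<le> \<bar>Re a\<bar> * \<bar>t\<bar>" by (simp flip: abs_mult)
  also have "\<dots> \<le> A * \<bar>t\<bar>" using assms by (intro mult_right_mono) auto
  finally have "Re a * t \<le> A * \<bar>t\<bar>" .
  moreover have "c * cosh t \<le> Re z * cosh t" using assms by (intro mult_right_mono) auto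
  ultimately show ?thesis by (simp add: bessel_kernel_def diff_mono)
qed

lemma integrable_bessel_kernel:
  assumes "Re z > 0"
  shows "integrable lborel (bessel_kernel a z)"
  by (rule Bochner_Integration.integrable_bound[OF integrable_exp_abs_minus_cosh[OF assms, of "\<bar>Re a\<bar>"]])
     (use norm_bessel_kernel_le[of a _ "Re z" z] in auto)

text \<open>A factor exp(t) or exp(-t) moves the order by 1 or -1. Thus the factors that arise from
  differentiating in \<open>z\<close> and in \<open>t\<close> turn into neighbouring orders.\<close>

lemma bessel_kernel_shift:
  "of_real (cosh t) * bessel_kernel a z t = (bessel_kernel (a + 1) z t + bessel_kernel (a - 1) z t) / 2"
  "of_real (sinh t) * bessel_kernel a z t = (bessel_kernel (a + 1) z t - bessel_kernel (a - 1) z t) / 2"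
proof -
  have *: "bessel_kernel (a + 1) z t = of_real (exp t) * bessel_kernel a z t"
    "bessel_kernel (a - 1) z t = of_real (exp (-t)) * bessel_kernel a z t"
    by (simp_all add: bessel_kernel_def algebra_simps flip: exp_add exp_of_real)
  show "of_real (cosh t) * bessel_kernel a z t = (bessel_kernel (a + 1) z t + bessel_kernel (a - 1) z t) / 2"
    "of_real (sinh t) * bessel_kernel a z t = (bessel_kernel (a + 1) z t - bessel_kernel (a - 1) z t) / 2"
    unfolding * cosh_field_def sinh_field_def by (simp_all add: algebra_simps add_divide_distrib diff_divide_distrib)
qed

lemma bessel_integral_uminus: "bessel_integral (-a) z = bessel_integral a z"
  using lborel_integral_real_affine[of "-1" "bessel_kernel a z" 0]
  by (simp add: bessel_integral_def bessel_kernel_def[abs_def])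

lemma has_field_derivative_bessel_integral:
  assumes "Re z > 0"
  shows "(bessel_integral a has_field_derivative - (bessel_integral (a + 1) z + bessel_integral (a - 1) z) / 2) (at z)"
proof -
  \<comment> \<open>Half of \<open>Re z\<close> gives an open convex half plane around
    \<open>z\<close> on which real parts stay away from 0, so one majorant serves all its
    points.\<close>
  define c where "c = Re z / 2"
  have c: "c > 0" "c < Re z" using assms by (auto simp: c_def)
  define S where "S = {w. c < Re w}"
  define f' where "f' = (\<lambda>w t. - (bessel_kernel (a + 1) w t + bessel_kernel (a - 1) w t) / 2)"
  define h where "h = (\<lambda>t. exp ((\<bar>Re a\<bar> + 1) * \<bar>t\<bar> - c * cosh t))"
  have "((\<lambda>z. integral\<^sup>L lborel (bessel_kernel a z)) has_field_derivative integral\<^sup>L lborel (f' z)) (at z)"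
  proof (rule has_field_derivative_integral[where S = S and h = h])
    show "open S" "convex S" by (auto simp: S_def open_halfspace_Re_gt convex_halfspace_Re_gt)
    show "z \<in> S" using c by (simp add: S_def)
    show "integrable lborel (bessel_kernel a z)" if "z \<in> S" for z
      using that c by (intro integrable_bessel_kernel) (auto simp: S_def)
    show "f' z \<in> borel_measurable lborel" by (simp add: f'_def)
    show "integrable lborel h" unfolding h_def by (rule integrable_exp_abs_minus_cosh) fact
    show "norm (f' w t) \<le> h t" if "w \<in> S" for w t
    proof -
      have "norm (bessel_kernel (a + 1) w t) \<le> h t" "norm (bessel_kernel (a - 1) w t) \<le> h t"
        unfolding h_def using that by (intro norm_bessel_kernel_le; simp add: S_def)+
      hence "norm (bessel_kernel (a + 1) w t + bessel_kernel (a - 1) w t) \<le> h t + h t"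
        by (rule norm_triangle_mono)
      thus ?thesis
        unfolding f'_def by (simp only: norm_divide norm_minus_cancel) simp
    qed
    show "((\<lambda>z. bessel_kernel a z t) has_field_derivative f' w t) (at w)" for w t
    proof -
      have "((\<lambda>z. bessel_kernel a z t) has_field_derivative - (of_real (cosh t) * bessel_kernel a w t)) (at w)"
        unfolding bessel_kernel_def by (auto intro!: derivative_eq_intros)
      also have "- (of_real (cosh t) * bessel_kernel a w t) = f' w t"
        by (simp only: f'_def bessel_kernel_shift minus_divide_left)
      finally show ?thesis .
    qed
  qed
  also have "integral\<^sup>L lborel (f' z) = - (bessel_integral (a + 1) z + bessel_integral (a - 1) z) / 2"
    using integrable_bessel_kernel[OF assms] by (simp add: f'_def bessel_integral_def)
  finally show ?thesis by (simp add: bessel_integral_def[abs_def])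
qed

lemma tendsto_bessel_integral_order:
  assumes "Re z > 0"
  shows "((\<lambda>b. bessel_integral b z) \<longlongrightarrow> bessel_integral a z) (at a)"
proof -
  have "((\<lambda>b. bessel_integral b z) \<longlongrightarrow> bessel_integral a z) (at a within ball a 1)"
    unfolding bessel_integral_def
  proof (rule tendsto_integral_dominated_within)
    show "integrable lborel (\<lambda>t. exp ((\<bar>Re a\<bar> + 1) * \<bar>t\<bar> - Re z * cosh t))"
      by (rule integrable_exp_abs_minus_cosh) fact
    show "norm (bessel_kernel b z t) \<le> exp ((\<bar>Re a\<bar> + 1) * \<bar>t\<bar> - Re z * cosh t)"
      if "b \<in> ball a 1 - {a}" for b t
    proof (rule norm_bessel_kernel_le)
      have "\<bar>Re (a - b)\<bar> \<le> 1"
        using that abs_Re_le_cmod[of "a - b"] by (auto simp: dist_norm)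
      thus "\<bar>Re b\<bar> \<le> \<bar>Re a\<bar> + 1" by simp
    qed simp
    show "((\<lambda>b. bessel_kernel b z t) \<longlongrightarrow> bessel_kernel a z t) (at a within ball a 1)" for t
      unfolding bessel_kernel_def by (intro tendsto_intros)
  qed auto
  thus ?thesis by (simp add: at_within_open[of a "ball a 1"])
qed

lemma tendsto_bessel_kernel_0:
  assumes "Re z > 0" "F = at_top \<or> F = at_bot"
  shows "(bessel_kernel a z \<longlongrightarrow> 0) F"
proof (rule Lim_null_comparison)
  let ?C = "exp ((\<bar>Re a\<bar> + 1)\<^sup>2 / Re z)"
  have "norm (bessel_kernel a z t) \<le> ?C * exp (- \<bar>t\<bar>)" for t
  proof -
    have "norm (bessel_kernel a z t) \<le> exp (\<bar>Re a\<bar> * \<bar>t\<bar> - Re z * cosh t)"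
      by (rule norm_bessel_kernel_le) auto
    also have "\<dots> \<le> exp ((\<bar>Re a\<bar> + 1)\<^sup>2 / Re z - \<bar>t\<bar>)"
      using abs_minus_cosh_le[OF assms(1)] by simp
    finally show ?thesis by (simp flip: exp_add)
  qed
  thus "\<forall>\<^sub>F t in F. norm (bessel_kernel a z t) \<le> ?C * exp (- \<bar>t\<bar>)" by simp
  have "filterlim (\<lambda>t::real. \<bar>t\<bar>) at_top F"
    using assms(2) filterlim_at_infinity_imp_norm_at_top[of "\<lambda>t::real. t" F] filterlim_ident[of F]
    by (auto simp: at_infinity_eq_at_top_bot filterlim_def le_supI1 le_supI2)
  hence "((\<lambda>t. exp (- \<bar>t\<bar>)) \<longlongrightarrow> 0) F"
    by (intro filterlim_compose[OF exp_at_bot] filterlim_compose[OF filterlim_uminus_at_bot_at_top])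
  thus "((\<lambda>t. ?C * exp (- \<bar>t\<bar>)) \<longlongrightarrow> 0) F"
    by (rule tendsto_mult_right_zero)
qed

text \<open>The derivative of the kernel in \<open>t\<close> is (a - z sinh t) times the kernel. Its
  integral over the line is 0, because the kernel vanishes at both ends.\<close>

lemma bessel_integral_recurrence:
  assumes "Re z > 0"
  shows "2 * a * bessel_integral a z = z * (bessel_integral (a + 1) z - bessel_integral (a - 1) z)"
proof -
  define f where "f = (\<lambda>t. a * bessel_kernel a z t - z * ((bessel_kernel (a + 1) z t - bessel_kernel (a - 1) z t) / 2))"
  note [simp] = integrable_bessel_kernel[OF assms]
  have "(LBINT t=-\<infinity>..\<infinity>. f t) = 0 - 0"
  proof (rule interval_integral_FTC_integrable)
    show "(bessel_kernel a z has_vector_derivative f t) (at t)" for t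
    proof -
      have "(bessel_kernel a z has_vector_derivative
          ((a - z * of_real (sinh t)) * bessel_kernel a z t)) (at t)"
        unfolding bessel_kernel_def
        by (rule has_vector_derivative_eq_rhs, rule field_vector_diff_chain_at[unfolded o_def, where g = exp])
           (auto intro!: derivative_eq_intros simp: mult.commute)
      also have "(a - z * of_real (sinh t)) * bessel_kernel a z t = f t"
        unfolding f_def bessel_kernel_shift(2)[symmetric] by (simp add: algebra_simps)
      finally show ?thesis .
    qed
    have "continuous_on UNIV f"
      unfolding f_def by (intro continuous_intros) auto
    thus "isCont f t" for t by (simp add: continuous_on_eq_continuous_at)
    show "set_integrable lborel (einterval (-\<infinity>) \<infinity>) f"
      by (simp add: set_integrable_def f_def)
    show "((bessel_kernel a z \<circ> real_of_ereal) \<longlongrightarrow> 0) (at_right (-\<infinity>))"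
         "((bessel_kernel a z \<circ> real_of_ereal) \<longlongrightarrow> 0) (at_left \<infinity>)"
      using tendsto_bessel_kernel_0[OF assms] unfolding ereal_tendsto_simps by auto
  qed auto
  hence "integral\<^sup>L lborel f = 0"
    by (simp add: interval_lebesgue_integral_def set_lebesgue_integral_def)
  thus ?thesis
    by (simp add: f_def bessel_integral_def field_simps)
qed

section \<open>The entire factor of I\<close>

text \<open>The Bessel-Clifford function: I_a(z) is (z/2)^a times its value at w = z^2/4. Splitting
  off the power leaves a function that is entire in \<open>w\<close> and has no branch cut.\<close>

definition bessel_series :: "complex \<Rightarrow> complex \<Rightarrow> complex" where
  "bessel_series a w = (\<Sum>k. rGamma (a + of_nat k + 1) / fact k * w ^ k)"

lemma summable_bessel_series: "summable (\<lambda>k. rGamma (a + complex_of_nat k + 1) / fact k * w ^ k)"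
proof -
  \<comment> \<open>From this index on, the norm of \<open>v\<close> below is at least k + 1 - |a|,
    hence at least 2 |w|, which yields the ratio 1/2.\<close>
  obtain N :: nat where N: "real N \<ge> norm a + 2 * norm w + 1" using real_arch_simple by blast
  show ?thesis
  proof (rule summable_ratio_test[where c = "1/2" and N = N])
    fix k assume k: "k \<ge> N"
    define r where "r = rGamma (a + of_nat (Suc k) + 1)"
    define v where "v = a + of_nat k + 1"
    \<comment> \<open>The functional equation is used as a product: \<open>v\<close> and
      \<open>r\<close> may be 0, so no quotient of consecutive terms is formed.\<close>
    have r: "rGamma (a + of_nat k + 1) = v * r"
      using rGamma_plus1[of "a + of_nat k + 1"] by (simp add: r_def v_def add_ac)
    have "norm (of_nat k + 1 :: complex) = real k + 1"
      by (metis norm_of_nat of_nat_Suc add.commute)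
    hence "norm v \<ge> real k + 1 - norm a"
      using norm_diff_ineq[of "of_nat k + 1" a] by (simp add: v_def add_ac)
    hence v: "norm v \<ge> 2 * norm w" using k N by linarith
    have "norm (r / fact (Suc k) * w ^ Suc k) = norm r * norm w * norm w ^ k / fact (Suc k)"
      by (simp add: norm_mult norm_divide norm_power del: fact_Suc)
    also have "\<dots> \<le> norm r * (norm v / 2) * norm w ^ k / fact (Suc k)"
      using v by (intro divide_right_mono mult_right_mono mult_left_mono) auto
    also have "\<dots> \<le> norm r * (norm v / 2) * norm w ^ k / fact k"
      by (intro divide_left_mono fact_mono) auto
    also have "\<dots> = 1/2 * norm (v * r / fact k * w ^ k)"
      by (simp add: norm_mult norm_divide norm_power)
    finally show "norm (rGamma (a + of_nat (Suc k) + 1) / fact (Suc k) * w ^ Suc k) \<le>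
        1/2 * norm (rGamma (a + of_nat k + 1) / fact k * w ^ k)"
      unfolding r r_def[symmetric] .
  qed simp
qed

lemma diffs_bessel_series:
  "diffs (\<lambda>k. rGamma (a + of_nat k + 1) / fact k) = (\<lambda>k. rGamma (a + 1 + of_nat k + 1) / fact k :: complex)"
proof
  fix k
  have "(of_nat (Suc k) :: complex) \<noteq> 0" by (simp del: of_nat_Suc)
  thus "diffs (\<lambda>k. rGamma (a + of_nat k + 1) / fact k) k = (rGamma (a + 1 + of_nat k + 1) / fact k :: complex)"
    by (simp add: diffs_def fact_Suc add_ac del: of_nat_Suc) (simp add: add_ac)
qed

lemma has_field_derivative_bessel_series:
  "(bessel_series a has_field_derivative bessel_series (a + 1) w) (at w)"
  using termdiffs_strong_converges_everywhere[OF summable_bessel_series, of a w]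
  by (simp add: diffs_bessel_series bessel_series_def[abs_def])

text \<open>The term \<open>w * bessel_series (a + 1) w\<close> is w times the derivative, so it has
  coefficients k c_k. The functional equation of \<open>rGamma\<close> turns (a + k) c_k into the
  coefficient for order a - 1.\<close>

lemma bessel_series_recurrence:
  "bessel_series (a - 1) w = a * bessel_series a w + w * bessel_series (a + 1) w"
proof -
  define c where "c = (\<lambda>k. rGamma (a + of_nat k + 1) / fact k :: complex)"
  have "(\<lambda>k. w * (diffs c k * w ^ k)) sums (w * bessel_series (a + 1) w)"
    unfolding c_def diffs_bessel_series bessel_series_def
    by (intro sums_mult summable_sums summable_bessel_series)
  hence "(\<lambda>k. of_nat (Suc k) * c (Suc k) * w ^ Suc k) sums (w * bessel_series (a + 1) w)"
    by (simp add: diffs_def mult_ac)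
  \<comment> \<open>The index moves down by one; the added term at k = 0 is zero.\<close>
  hence "(\<lambda>k. of_nat k * c k * w ^ k) sums (w * bessel_series (a + 1) w)"
    by (subst (asm) sums_Suc_iff) simp
  moreover have "(\<lambda>k. a * (c k * w ^ k)) sums (a * bessel_series a w)"
    unfolding c_def bessel_series_def by (intro sums_mult summable_sums summable_bessel_series)
  ultimately have "(\<lambda>k. a * (c k * w ^ k) + of_nat k * c k * w ^ k) sums
      (a * bessel_series a w + w * bessel_series (a + 1) w)"
    by (intro sums_add)
  also have "(\<lambda>k. a * (c k * w ^ k) + of_nat k * c k * w ^ k) =
      (\<lambda>k. rGamma (a - 1 + of_nat k + 1) / fact k * w ^ k)"
  proof
    fix k
    show "a * (c k * w ^ k) + of_nat k * c k * w ^ k = rGamma (a - 1 + of_nat k + 1) / fact k * w ^ k"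
      unfolding c_def using arg_cong[OF rGamma_plus1[of "a + of_nat k"], of "\<lambda>r. r / fact k * w ^ k"]
      by (simp add: algebra_simps add_divide_distrib)
  qed
  finally show ?thesis by (simp add: sums_iff bessel_series_def)
qed

lemma bessel_series_0: "bessel_series a 0 = rGamma (a + 1)"
  unfolding bessel_series_def by (subst powser_zero) simp

text \<open>By the recurrences at \<open>m\<close> and \<open>1 - m\<close> the derivative in
  \<open>w\<close> vanishes. The constant is read off at \<open>w = 0\<close>, where the reflection
  formula evaluates \<open>rGamma (1 - m) * rGamma m\<close>.\<close>

lemma bessel_series_wronskian:
  "bessel_series (-m) w * bessel_series (m - 1) w - w * bessel_series (1 - m) w * bessel_series m w =
     sin (of_real pi * m) / of_real pi"
proof -
  define f where "f = (\<lambda>w. bessel_series (-m) w * bessel_series (m - 1) w -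
    w * bessel_series (1 - m) w * bessel_series m w)"
  have "(f has_field_derivative 0) (at u)" for u
  proof -
    note [derivative_intros] = has_field_derivative_bessel_series[THEN DERIV_chain2]
    have rec: "bessel_series (m - 1) u = m * bessel_series m u + u * bessel_series (m + 1) u"
      "bessel_series (-m) u = (1 - m) * bessel_series (1 - m) u + u * bessel_series (1 - m + 1) u"
      using bessel_series_recurrence[of m u] bessel_series_recurrence[of "1 - m" u] by simp_all
    show ?thesis
      unfolding f_def by (rule derivative_eq_intros refl)+ (simp add: rec algebra_simps)
  qed
  then obtain c where "\<And>u. f u = c"
    using has_field_derivative_zero_constant[of UNIV f] by auto
  hence "f w = f 0" by simp
  also have "f 0 = sin (of_real pi * m) / of_real pi"
    using rGamma_reflection_complex[of m] by (simp add: f_def bessel_series_0 mult.commute)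
  finally show ?thesis by (simp add: f_def)
qed

section \<open>Behaviour of J near 0\<close>

lemma integrable_exp_minus_exp:
  fixes \<beta> :: real
  assumes "\<beta> > 0"
  shows "integrable lborel (\<lambda>t. exp (\<beta> * t - exp t))"
proof (rule Bochner_Integration.integrable_bound)
  let ?C = "(\<beta> + 1)\<^sup>2 / 2"
  \<comment> \<open>One rate for both sides: the decay is at least exp(-t) on the right, up to a
    constant, and exp(\<beta> t) on the left.\<close>
  define m where "m = min \<beta> 1"
  have m: "0 < m" "m \<le> \<beta>" "m \<le> 1" using assms by (auto simp: m_def)
  show "integrable lborel (\<lambda>t::real. exp ?C * exp (- (m * \<bar>t\<bar>)))"
    using m by (intro integrable_mult_right integrable_exp_neg_abs) auto
  have "\<beta> * t - exp t \<le> ?C - m * \<bar>t\<bar>" for t :: real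
  proof (cases "t \<ge> 0")
    case True
    have "0 \<le> (t - (\<beta> + 1))\<^sup>2 / 2" by simp
    hence "(\<beta> + 1) * t - t\<^sup>2 / 2 \<le> ?C" by (simp add: power2_eq_square field_simps)
    moreover have "t\<^sup>2 / 2 \<le> exp t" using exp_lower_Taylor_quadratic[OF True] True by simp
    moreover have "m * t \<le> t" using mult_right_mono[OF m(3) True] by simp
    ultimately show ?thesis using True by (simp add: algebra_simps)
  next
    case False
    hence "\<beta> * t \<le> m * t" using m by (intro mult_right_mono_neg) auto
    moreover have "0 \<le> ?C" by simp
    ultimately show ?thesis using False exp_gt_zero[of t] by linarith
  qed
  thus "AE t in lborel. norm (exp (\<beta> * t - exp t)) \<le> norm (exp ?C * exp (- (m * \<bar>t\<bar>)))"
    by (simp flip: exp_add)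
qed simp

text \<open>Euler's integral after the substitution u = exp(t).\<close>

lemma Gamma_integral_exp:
  assumes "Re b > 0"
  shows "(LBINT t. exp (b * of_real t - of_real (exp t))) = Gamma b"
proof -
  define f where "f = (\<lambda>u. complex_of_real u powr (b - 1) / of_real (exp u))"
  have sub: "exp t *\<^sub>R f (exp t) = exp (b * of_real t - of_real (exp t))" for t
  proof -
    have "complex_of_real (exp t) powr (b - 1) = exp ((b - 1) * of_real t)"
      by (simp add: powr_def Ln_of_real)
    thus ?thesis
      unfolding f_def scaleR_conv_of_real
      by (simp add: algebra_simps exp_diff exp_add flip: exp_of_real)
  qed
  have cont: "continuous_on {0<..} f"
    unfolding f_def by (intro continuous_intros) auto
  have "integrable lborel (\<lambda>t. exp (b * of_real t - of_real (exp t)))"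
    by (rule Bochner_Integration.integrable_bound[OF integrable_exp_minus_exp[OF assms]]) auto
  hence int1: "set_integrable lborel (einterval (-\<infinity>) \<infinity>) (\<lambda>t. exp t *\<^sub>R f (exp t))"
    unfolding sub by (simp add: set_integrable_def)
  have "set_integrable lebesgue {0<..} f"
    using absolutely_integrable_Gamma_integral'[OF assms] by (simp add: f_def)
  \<comment> \<open>Passing from the completed measure to \<open>lborel\<close> requires Borel
    measurability, which continuity of \<open>f\<close> supplies.\<close>
  hence int2: "set_integrable lborel {0<..} f"
    unfolding set_integrable_def
    by (subst (asm) integrable_completion)
       (use borel_measurable_continuous_on_indicator[OF _ cont] in auto)
  have ei: "einterval 0 \<infinity> = {0<..}" by (auto simp: einterval_def)
  have "(LBINT u=0..\<infinity>. f u) = (LBINT t=-\<infinity>..\<infinity>. exp t *\<^sub>R f (exp t))"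
  proof (rule interval_integral_substitution_integrable)
    show "isCont f (exp t)" for t
      using cont continuous_on_eq_continuous_at[of "{0<..}" f] by auto
    show "((ereal \<circ> exp \<circ> real_of_ereal) \<longlongrightarrow> 0) (at_right (-\<infinity>))"
      unfolding ereal_tendsto_simps zero_ereal_def using exp_at_bot by simp
    show "((ereal \<circ> exp \<circ> real_of_ereal) \<longlongrightarrow> \<infinity>) (at_left \<infinity>)"
      unfolding ereal_tendsto_simps using exp_at_top by simp
  qed (use int1 int2 in \<open>auto simp: ei intro!: derivative_eq_intros\<close>)
  hence "(LBINT t. exp (b * of_real t - of_real (exp t))) = (LBINT u:{0<..}. f u)"
    unfolding sub by (simp add: interval_lebesgue_integral_def ei set_lebesgue_integral_def)
  also have "\<dots> = integral {0<..} f" by (rule set_borel_integral_eq_integral[OF int2])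
  also have "\<dots> = Gamma b"
    using Gamma_integral_complex'[OF assms] by (auto simp: f_def intro: integral_unique)
  finally show ?thesis .
qed

text \<open>Translating \<open>t\<close> by -ln s turns 2 s cosh t into exp(t) + s^2 exp(-t) and
  produces a factor that cancels the power of \<open>s\<close>. Now \<open>s\<close> occurs only in
  a factor of modulus at most 1 that tends to 1 as s tends to 0.\<close>

lemma bessel_integral_rescale:
  assumes "s > 0"
  shows "of_real s powr b * bessel_integral b (of_real (2 * s)) =
    (LBINT t. exp (b * of_real t - of_real (exp t) - of_real (s\<^sup>2 * exp (-t))))"
proof -
  have "bessel_integral b (of_real (2 * s)) = (LBINT t. bessel_kernel b (of_real (2 * s)) (- ln s + 1 * t))"
    unfolding bessel_integral_def by (subst lborel_integral_real_affine[of 1 _ "- ln s"]) auto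
  hence "of_real s powr b * bessel_integral b (of_real (2 * s)) =
    (LBINT t. of_real s powr b * bessel_kernel b (of_real (2 * s)) (- ln s + 1 * t))" by simp
  also have "(\<lambda>t. of_real s powr b * bessel_kernel b (of_real (2 * s)) (- ln s + 1 * t)) =
    (\<lambda>t. exp (b * of_real t - of_real (exp t) - of_real (s\<^sup>2 * exp (-t))))"
  proof
    fix t
    have "2 * s * cosh (- ln s + t) = exp t + s\<^sup>2 * exp (-t)"
      using assms by (simp add: cosh_field_def exp_diff exp_add exp_minus power2_eq_square field_simps)
    hence "bessel_kernel b (of_real (2 * s)) (- ln s + 1 * t) =
        exp (b * of_real (- ln s + t) - of_real (exp t + s\<^sup>2 * exp (-t)))"
      unfolding bessel_kernel_def by (metis mult_1 of_real_mult)
    moreover have "of_real s powr b = exp (b * of_real (ln s))"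
      using assms by (simp add: powr_def Ln_of_real)
    ultimately show "of_real s powr b * bessel_kernel b (of_real (2 * s)) (- ln s + 1 * t) =
        exp (b * of_real t - of_real (exp t) - of_real (s\<^sup>2 * exp (-t)))"
      by (simp add: algebra_simps flip: exp_add)
  qed
  finally show ?thesis .
qed

lemma tendsto_bessel_integral_0:
  assumes "Re b > 0"
  shows "((\<lambda>s. of_real s powr b * bessel_integral b (of_real (2 * s))) \<longlongrightarrow> Gamma b) (at_right 0)"
proof -
  have "((\<lambda>s. (LBINT t. exp (b * of_real t - of_real (exp t) - of_real (s\<^sup>2 * exp (-t))))) \<longlongrightarrow>
      (LBINT t. exp (b * of_real t - of_real (exp t)))) (at 0 within {0<..})"
  proof (rule tendsto_integral_dominated_within[OF _ _ integrable_exp_minus_exp[OF assms]])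
    show "((\<lambda>s. exp (b * of_real t - of_real (exp t) - of_real (s\<^sup>2 * exp (-t)))) \<longlongrightarrow>
        exp (b * of_real t - of_real (exp t))) (at 0 within {0<..})" for t
      by (rule tendsto_eq_intros refl | simp)+
  qed auto
  hence "((\<lambda>s. (LBINT t. exp (b * of_real t - of_real (exp t) - of_real (s\<^sup>2 * exp (-t))))) \<longlongrightarrow>
      Gamma b) (at 0 within {0<..})"
    using Gamma_integral_exp[OF assms] by simp
  thus ?thesis
    by (rule Lim_transform_within[OF _ zero_less_one]) (simp only: bessel_integral_rescale greaterThan_iff)
qed

section \<open>The cross product of J and I\<close>

text \<open>\<open>z/2 (J\<^sub>a I\<^sub>a\<^sub>+\<^sub>1 + J\<^sub>a\<^sub>+\<^sub>1 I\<^sub>a)\<close>, with the common power of \<open>z/2\<close> factored out.\<close>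
definition bessel_cross :: "complex \<Rightarrow> complex \<Rightarrow> complex" where
  "bessel_cross a z = (z / 2) powr (a + 1) *
     (z / 2 * bessel_integral a z * bessel_series (a + 1) (z\<^sup>2 / 4) +
      bessel_integral (a + 1) z * bessel_series a (z\<^sup>2 / 4))"

text \<open>The two recurrences exchange the term a J_a against one another: it completes J_(a-1) to
  J_(a+1) and arises from the series of order a - 1. The leftover factor z/2 is absorbed by the
  power.\<close>

lemma bessel_cross_periodic:
  assumes "Re z > 0"
  shows "bessel_cross (a - 1) z = bessel_cross a z"
proof -
  have z: "z \<noteq> 0" using assms by auto
  have "z / 2 * bessel_integral (a - 1) z + a * bessel_integral a z = z / 2 * bessel_integral (a + 1) z"
    using bessel_integral_recurrence[OF assms, of a] by (simp add: algebra_simps)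
  hence "z / 2 * bessel_integral (a - 1) z * bessel_series a (z\<^sup>2 / 4) +
      bessel_integral a z * bessel_series (a - 1) (z\<^sup>2 / 4) =
      z / 2 * (z / 2 * bessel_integral a z * bessel_series (a + 1) (z\<^sup>2 / 4) +
      bessel_integral (a + 1) z * bessel_series a (z\<^sup>2 / 4))"
    unfolding bessel_series_recurrence[of a "z\<^sup>2 / 4"]
    by (simp add: power2_eq_square) algebra
  moreover have "(z / 2) powr (a + 1) = (z / 2) powr a * (z / 2)"
    using z by (simp add: powr_add)
  ultimately show ?thesis by (simp only: bessel_cross_def diff_add_cancel mult.assoc)
qed

lemma bessel_cross_eq_1:
  assumes "Re z > 0"
  shows "bessel_cross a z = 1"
proof -
  \<comment> \<open>For \<open>Re a > 0\<close> the limits of both integrals at 0, suitably scaled,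
    are Gamma values.\<close>
  have main: "bessel_cross a z = 1" if a: "Re a > 0" and z: "Re z > 0" for a z
  proof -
    have "(bessel_cross a has_field_derivative 0) (at z)" if z: "Re z > 0" for z
    proof -
      define P where "P = (z / 2) powr (a + 1)"
      define J where "J = (\<lambda>k. bessel_integral (a + k) z)"
      define T where "T = (\<lambda>k. bessel_series (a + k) (z\<^sup>2 / 4))"
      have z0: "z \<noteq> 0" and nonpos: "z / 2 \<notin> \<real>\<^sub>\<le>\<^sub>0" using z by (auto simp: complex_nonpos_Reals_iff)
      \<comment> \<open>The recurrence eliminates J_(a-1) here and J_(a+2) in the next fact, so that
        only the two orders of the cross product remain.\<close>
      have J0: "(bessel_integral a has_field_derivative - J 1 + a / z * J 0) (at z)"
        using has_field_derivative_bessel_integral[OF z, of a] bessel_integral_recurrence[OF z, of a] z0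
        by (auto elim!: DERIV_cong simp: J_def field_simps)
      have J1: "(bessel_integral (a + 1) has_field_derivative - J 0 - (a + 1) / z * J 1) (at z)"
        using has_field_derivative_bessel_integral[OF z, of "a + 1"] bessel_integral_recurrence[OF z, of "a + 1"] z0
        by (auto elim!: DERIV_cong simp: J_def field_simps)
      have T: "((\<lambda>z. bessel_series (a + k) (z\<^sup>2 / 4)) has_field_derivative T (k + 1) * (z / 2)) (at z)" for k
        by (rule DERIV_cong, rule has_field_derivative_bessel_series[THEN DERIV_chain2])
           (auto intro!: derivative_eq_intros simp: T_def add_ac)
      have P: "((\<lambda>z. (z / 2) powr (a + 1)) has_field_derivative (a + 1) / z * P) (at z)"
      proof -
        have "((\<lambda>z. (z / 2) powr (a + 1)) has_field_derivative (a + 1) * (z / 2) powr (a + 1 - 1) * (1 / 2)) (at z)"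
          using nonpos by (auto intro!: derivative_eq_intros)
        also have "(z / 2) powr (a + 1 - 1) = P / (z / 2)"
          using z0 unfolding P_def by (subst powr_diff) auto
        also have "(a + 1) * (P / (z / 2)) * (1 / 2) = (a + 1) / z * P" using z0 by simp
        finally show ?thesis .
      qed
      have rec: "T 0 = (a + 1) * T 1 + z\<^sup>2 / 4 * T 2"
        using bessel_series_recurrence[of "a + 1" "z\<^sup>2 / 4"] by (simp add: T_def add_ac)
      have "(bessel_cross a has_field_derivative
          (a + 1) / z * P * (z / 2 * J 0 * T 1 + J 1 * T 0) +
          P * ((1 / 2 * J 0 + z / 2 * (- J 1 + a / z * J 0)) * T 1 + z / 2 * J 0 * (T 2 * (z / 2)) +
               ((- J 0 - (a + 1) / z * J 1) * T 0 + J 1 * (T 1 * (z / 2))))) (at z)"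
        unfolding bessel_cross_def
        by (rule DERIV_cong[OF DERIV_mult[OF P DERIV_add[OF
              DERIV_mult[OF DERIV_mult[OF DERIV_cdivide[OF DERIV_ident] J0] T[of 1]]
              DERIV_mult[OF J1 T[of 0, unfolded add_0_right]]]]])
           (simp add: P_def J_def T_def algebra_simps)
      also have "(a + 1) / z * P * (z / 2 * J 0 * T 1 + J 1 * T 0) +
          P * ((1 / 2 * J 0 + z / 2 * (- J 1 + a / z * J 0)) * T 1 + z / 2 * J 0 * (T 2 * (z / 2)) +
               ((- J 0 - (a + 1) / z * J 1) * T 0 + J 1 * (T 1 * (z / 2)))) = 0"
        using z0 unfolding rec by (simp add: field_simps power2_eq_square)
      finally show ?thesis .
    qed
    hence "\<exists>c. \<forall>z\<in>{z. Re z > 0}. bessel_cross a z = c"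
      by (intro has_field_derivative_zero_constant convex_halfspace_Re_gt)
         (auto intro: has_field_derivative_at_within)
    then obtain c where c: "\<And>z. Re z > 0 \<Longrightarrow> bessel_cross a z = c" by auto
    define G where "G = (\<lambda>b s. of_real s powr b * bessel_integral b (complex_of_real (2 * s)))"
    have G: "(G b \<longlongrightarrow> Gamma b) (at_right 0)" if "Re b > 0" for b
      unfolding G_def by (rule tendsto_bessel_integral_0[OF that])
    have T: "((\<lambda>s. bessel_series b ((of_real s)\<^sup>2)) \<longlongrightarrow> bessel_series b 0) (at_right 0)" for b
      by (rule isCont_tendsto_compose[OF DERIV_isCont[OF has_field_derivative_bessel_series]])
         (rule tendsto_eq_intros refl | simp)+
    \<comment> \<open>This is the cross product at z = 2 s. The first summand carries an extra s^2
      and dies out; the second tends to \<open>Gamma (a + 1) * rGamma (a + 1)\<close>.\<close>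
    have "((\<lambda>s. (of_real s)\<^sup>2 * G a s * bessel_series (a + 1) ((of_real s)\<^sup>2) +
        G (a + 1) s * bessel_series a ((of_real s)\<^sup>2)) \<longlongrightarrow>
        (of_real 0)\<^sup>2 * Gamma a * bessel_series (a + 1) 0 + Gamma (a + 1) * bessel_series a 0) (at_right 0)"
      using a by (intro tendsto_intros G T) auto
    moreover have "(of_real s)\<^sup>2 * G a s * bessel_series (a + 1) ((of_real s)\<^sup>2) +
        G (a + 1) s * bessel_series a ((of_real s)\<^sup>2) = c" if "s > 0" for s
    proof -
      have "bessel_cross a (of_real (2 * s)) = c" using that by (intro c) auto
      moreover have "complex_of_real s powr (a + 1) = of_real s powr a * of_real s"
        using that by (simp add: powr_add)
      ultimately show ?thesis
        by (simp add: bessel_cross_def G_def power2_eq_square algebra_simps)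
    qed
    ultimately have "((\<lambda>s::real. c) \<longlongrightarrow>
        (of_real 0)\<^sup>2 * Gamma a * bessel_series (a + 1) 0 + Gamma (a + 1) * bessel_series a 0) (at_right 0)"
      by (elim Lim_transform_within[OF _ zero_less_one]) auto
    hence "c = Gamma (a + 1) * bessel_series a 0" by (simp add: tendsto_const_iff)
    also have "\<dots> = 1"
    proof -
      have "a + 1 \<notin> \<int>\<^sub>\<le>\<^sub>0" using a by (auto elim!: nonpos_Ints_cases simp: complex_eq_iff)
      thus ?thesis by (simp add: bessel_series_0 rGamma_inverse_Gamma Gamma_eq_zero_iff)
    qed
    finally show ?thesis using c z by simp
  qed
  \<comment> \<open>Periodicity reduces an arbitrary order to one with positive real part.\<close>
  obtain n :: nat where "- Re a < real n"
    using reals_Archimedean2 by blast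
  hence n: "Re a + real n > 0" by linarith
  have "bessel_cross (a + of_nat n) z = bessel_cross a z" for n
  proof (induction n)
    case (Suc n)
    thus ?case using bessel_cross_periodic[OF assms, of "a + of_nat (Suc n)"] by (simp add: algebra_simps)
  qed simp
  with main[of "a + of_nat n" z] n assms show ?thesis by simp
qed

section \<open>K as half of J\<close>

lemma bessel_I_diff:
  assumes "Re z > 0"
  shows "bessel_I (-m) z - bessel_I m z = sin (of_real pi * m) / of_real pi * bessel_integral m z"
proof -
  define P where "P = (z / 2) powr m"
  have z0: "z \<noteq> 0" using assms by auto
  have P0: "P \<noteq> 0" using z0 by (simp add: P_def)
  have Pm: "(z / 2) powr (-m) = 1 / P" "(z / 2) powr (1 - m) = z / 2 / P"
    using z0 by (simp_all add: P_def powr_minus powr_diff field_simps)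
  define T where "T = (\<lambda>b. bessel_series b (z\<^sup>2 / 4))"
  have I: "bessel_I b z = (z / 2) powr b * T b" for b
    by (simp add: bessel_I_def T_def bessel_series_def mult_ac)
  define X where "X = bessel_integral m z"
  define Y where "Y = bessel_integral (m - 1) z"
  \<comment> \<open>Evenness of J in the order makes \<open>X\<close> and \<open>Y\<close> the only
    unknowns in both linear equations.\<close>
  have Y': "bessel_integral (1 - m) z = Y" "bessel_integral (-m) z = X"
    using bessel_integral_uminus[of "m - 1" z] bessel_integral_uminus[of m z] by (simp_all add: X_def Y_def)
  have 1: "P * (z / 2 * Y * T m + X * T (m - 1)) = 1"
    using bessel_cross_eq_1[OF assms, of "m - 1"] by (simp add: bessel_cross_def P_def X_def Y_def T_def)
  have 2: "z / 2 / P * (z / 2 * X * T (1 - m) + Y * T (-m)) = 1"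
    using bessel_cross_eq_1[OF assms, of "- m"] by (simp add: bessel_cross_def Y' Pm T_def)
  \<comment> \<open>Cramer's rule: weighting the equations with \<open>T (-m)\<close> and
    \<open>T m\<close> eliminates \<open>Y\<close>, and the coefficient of \<open>X\<close> is the
    Wronskian.\<close>
  have "sin (of_real pi * m) / of_real pi * X = (T (-m) * T (m - 1) - z\<^sup>2 / 4 * T (1 - m) * T m) * X"
    using bessel_series_wronskian[of m "z\<^sup>2 / 4"] by (simp add: T_def)
  also have "\<dots> = T (-m) * (z / 2 * Y * T m + X * T (m - 1)) - T m * (z / 2 * (z / 2 * X * T (1 - m) + Y * T (-m)))"
    by (simp add: algebra_simps power2_eq_square)
  also have "z / 2 * Y * T m + X * T (m - 1) = 1 / P"
    using 1 P0 by (simp add: field_simps)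
  also have "z / 2 * (z / 2 * X * T (1 - m) + Y * T (-m)) = P"
    using 2 P0 by (simp add: field_simps)
  finally show ?thesis
    by (simp add: I Pm X_def) (simp add: P_def mult_ac)
qed

lemma bessel_K_eq_integral:
  assumes "Re z > 0"
  shows "bessel_K \<mu> z = bessel_integral \<mu> z / 2"
proof -
  define Q where "Q = (\<lambda>m. of_real pi / 2 * (bessel_I (- m) z - bessel_I m z) / sin (m * of_real pi))"
  have Q: "Q m = bessel_integral m z / 2" if "m \<notin> \<int>" for m
  proof -
    have "sin (m * of_real pi) \<noteq> 0"
      using that by (auto simp: sin_eq_0)
    thus ?thesis by (simp add: Q_def bessel_I_diff[OF assms] mult.commute)
  qed
  \<comment> \<open>The punctured unit disc around an integer contains no integer, so there
    \<open>Q\<close> agrees with a function that extends continuously to the centre.\<close>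
  have "(Q \<longlongrightarrow> bessel_integral \<mu> z / 2) (at \<mu>)" if "\<mu> \<in> \<int>"
  proof (rule Lim_transform_within[where d = 1])
    show "((\<lambda>b. bessel_integral b z / 2) \<longlongrightarrow> bessel_integral \<mu> z / 2) (at \<mu>)"
      by (intro tendsto_intros tendsto_bessel_integral_order assms) auto
    show "bessel_integral b z / 2 = Q b" if "0 < dist b \<mu>" "dist b \<mu> < 1" for b
    proof -
      have "b \<notin> \<int>"
      proof
        assume "b \<in> \<int>"
        then obtain i where "b - \<mu> = of_int i" using \<open>\<mu> \<in> \<int>\<close> by (meson Ints_diff Ints_cases)
        with that show False by (auto simp: dist_norm)
      qed
      thus ?thesis by (simp add: Q)
    qed
  qed simp
  hence "\<mu> \<in> \<int> \<Longrightarrow> Lim (at \<mu>) Q = bessel_integral \<mu> z / 2"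
    by (intro tendsto_Lim) auto
  thus ?thesis unfolding bessel_K_def Let_def Q_def[symmetric] using Q by auto
qed

section \<open>Decay of K and integrability of the Beta integrand\<close>

text \<open>Write Re z = c + (Re z - c). As cosh is at least 1, the second part yields the
  exponential factor, and the remaining integral is independent of \<open>z\<close>.\<close>

lemma norm_bessel_integral_le:
  assumes "0 < c" "c \<le> Re z"
  shows "norm (bessel_integral a z) \<le> exp (c - Re z) * (LBINT t. exp (\<bar>Re a\<bar> * \<bar>t\<bar> - c * cosh t))"
proof -
  note int = integrable_exp_abs_minus_cosh[OF assms(1), of "\<bar>Re a\<bar>"]
  have "norm (bessel_integral a z) \<le> (LBINT t. exp (c - Re z) * exp (\<bar>Re a\<bar> * \<bar>t\<bar> - c * cosh t))"
    unfolding bessel_integral_def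
  proof (rule order_trans[OF integral_norm_bound integral_mono])
    show "integrable lborel (\<lambda>t. norm (bessel_kernel a z t))"
      using assms by (intro integrable_norm integrable_bessel_kernel) auto
    show "norm (bessel_kernel a z t) \<le> exp (c - Re z) * exp (\<bar>Re a\<bar> * \<bar>t\<bar> - c * cosh t)" for t
    proof -
      have "(Re z - c) * 1 \<le> (Re z - c) * cosh t"
        using assms cosh_real_ge_1[of t] by (intro mult_left_mono) auto
      hence "exp (\<bar>Re a\<bar> * \<bar>t\<bar> - Re z * cosh t) \<le> exp (c - Re z) * exp (\<bar>Re a\<bar> * \<bar>t\<bar> - c * cosh t)"
        by (simp add: algebra_simps flip: exp_add)
      thus ?thesis using norm_bessel_kernel_le[of a "\<bar>Re a\<bar>" "Re z" z t] by simp
    qed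
  qed (use int in auto)
  thus ?thesis by simp
qed

text \<open>On the unit interval t^\<beta> is at most t^(-\<gamma>), and ln u \<le> u at u =
  c/(\<gamma> t) lets exp(-c/t) absorb this power.\<close>

lemma powr_times_exp_inverse_bounded:
  fixes \<beta> c :: real
  assumes "c > 0"
  obtains B where "B > 0" "\<And>t. 0 < t \<Longrightarrow> t < 1 \<Longrightarrow> t powr \<beta> * exp (- (c / t)) \<le> B"
proof
  define \<gamma> where "\<gamma> = \<bar>\<beta>\<bar> + 1"
  have \<gamma>: "\<gamma> > 0" "- \<gamma> \<le> \<beta>" by (auto simp: \<gamma>_def)
  show "exp (\<gamma> * ln (\<gamma> / c)) > 0" by simp
  show "t powr \<beta> * exp (- (c / t)) \<le> exp (\<gamma> * ln (\<gamma> / c))" if t: "0 < t" "t < 1" for t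
  proof -
    have "\<beta> * ln t \<le> (- \<gamma>) * ln t" using \<gamma> t by (intro mult_right_mono_neg) auto
    also have "- ln t = ln (c / (\<gamma> * t)) + ln (\<gamma> / c)"
      using \<gamma> t assms by (simp add: ln_div ln_mult)
    hence "(- \<gamma>) * ln t = \<gamma> * ln (c / (\<gamma> * t)) + \<gamma> * ln (\<gamma> / c)"
      by (metis minus_mult_commute distrib_left)
    also have "\<gamma> * ln (c / (\<gamma> * t)) \<le> \<gamma> * (c / (\<gamma> * t))"
      using \<gamma> t assms ln_bound[of "c / (\<gamma> * t)"] by (intro mult_left_mono) auto
    also have "\<gamma> * (c / (\<gamma> * t)) = c / t" using \<gamma> by simp
    finally show ?thesis using t by (simp add: powr_def flip: exp_add)
  qed
qed

context
  fixes x y \<mu> p :: complex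
  assumes p: "Re p > 0"
begin

text \<open>Partial fractions split the decay into one part for each endpoint; the lower bound keeps
  the argument in a fixed half plane.\<close>

lemma Re_beta_argument:
  assumes "0 < t" "t < 1"
  shows "Re (p / of_real (t * (1 - t))) = Re p / t + Re p / (1 - t)"
    and "Re (p / of_real (t * (1 - t))) \<ge> Re p"
proof -
  have eq: "Re (p / of_real (t * (1 - t))) = Re p / (t * (1 - t))" by (rule Re_divide_of_real)
  show "Re (p / of_real (t * (1 - t))) = Re p / t + Re p / (1 - t)"
    unfolding eq using assms by (simp add: field_simps)
  have "t * (1 - t) \<le> 1" using assms by (intro mult_le_one) auto
  thus "Re (p / of_real (t * (1 - t))) \<ge> Re p"
    unfolding eq using assms p by (simp add: le_divide_eq_1 pos_le_divide_eq mult_left_le)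
qed

text \<open>The integrand is bounded on a bounded interval: the decay of K beats any power of
  \<open>t\<close> at 0 and of \<open>1 - t\<close> at 1.\<close>

lemma ext_Beta_integrand_integrable:
  "set_integrable lborel {0<..<1}
     (\<lambda>t. of_real t powr x * of_real (1 - t) powr y * bessel_K \<mu> (p / of_real (t * (1 - t))))"
  (is "set_integrable _ _ ?f")
proof -
  define M where "M = (LBINT t. exp (\<bar>Re \<mu>\<bar> * \<bar>t\<bar> - Re p * cosh t))"
  have M: "M \<ge> 0" unfolding M_def by (rule Bochner_Integration.integral_nonneg) simp
  obtain B1 where B1: "B1 > 0" "\<And>t. 0 < t \<Longrightarrow> t < 1 \<Longrightarrow> t powr Re x * exp (- (Re p / t)) \<le> B1"
    using powr_times_exp_inverse_bounded[OF p] by blast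
  obtain B2 where B2: "B2 > 0" "\<And>t. 0 < t \<Longrightarrow> t < 1 \<Longrightarrow> t powr Re y * exp (- (Re p / t)) \<le> B2"
    using powr_times_exp_inverse_bounded[OF p] by blast
  define C where "C = B1 * B2 * (exp (Re p) * M / 2)"
  have bound: "norm (?f t) \<le> C" if t: "0 < t" "t < 1" for t
  proof -
    let ?z = "p / of_real (t * (1 - t))"
    have K: "bessel_K \<mu> ?z = bessel_integral \<mu> ?z / 2"
      using Re_beta_argument(2)[OF t] p by (intro bessel_K_eq_integral) linarith
    have "norm (bessel_integral \<mu> ?z) \<le> exp (Re p - Re ?z) * M"
      unfolding M_def by (rule norm_bessel_integral_le[OF p Re_beta_argument(2)[OF t]])
    also have "exp (Re p - Re ?z) = exp (Re p) * exp (- (Re p / t)) * exp (- (Re p / (1 - t)))"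
      unfolding Re_beta_argument(1)[OF t] by (simp flip: exp_add)
    finally have "norm (bessel_K \<mu> ?z) \<le>
        exp (Re p) * exp (- (Re p / t)) * exp (- (Re p / (1 - t))) * M / 2"
      unfolding K by (simp add: norm_divide)
    moreover have "norm (of_real t powr x) = t powr Re x" "norm (of_real (1 - t) powr y) = (1 - t) powr Re y"
      using t norm_powr_real_powr[of "of_real t" x] norm_powr_real_powr[of "of_real (1 - t)" y] by auto
    ultimately have "norm (?f t) \<le> t powr Re x * (1 - t) powr Re y *
        (exp (Re p) * exp (- (Re p / t)) * exp (- (Re p / (1 - t))) * M / 2)"
      unfolding norm_mult by (intro mult_mono) simp_all
    also have "\<dots> = (t powr Re x * exp (- (Re p / t))) * ((1 - t) powr Re y * exp (- (Re p / (1 - t))))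
        * (exp (Re p) * M / 2)" by (simp add: mult_ac)
    \<comment> \<open>The bound \<open>B2\<close> is applied at \<open>1 - t\<close>.\<close>
    also have "\<dots> \<le> C"
      unfolding C_def using B1 B2 M t by (intro mult_mono mult_nonneg_nonneg) auto
    finally show ?thesis .
  qed
  \<comment> \<open>Measurability comes from the integral form, as the definition of K by cases and
    limits does not display continuity.\<close>
  have "continuous_on {0<..<1} (\<lambda>t. of_real t powr x * of_real (1 - t) powr y *
      (bessel_integral \<mu> (p / of_real (t * (1 - t))) / 2))"
  proof -
    have "continuous_on {z. Re z > 0} (bessel_integral \<mu>)"
      using has_field_derivative_bessel_integral DERIV_isCont
      by (blast intro: continuous_at_imp_continuous_on)
    hence "continuous_on {0<..<1} (\<lambda>t. bessel_integral \<mu> (p / of_real (t * (1 - t))))"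
      by (rule continuous_on_compose2)
         (use Re_beta_argument p in \<open>force intro!: continuous_intros\<close>)+
    thus ?thesis
      by (intro continuous_intros) auto
  qed
  also have "?this \<longleftrightarrow> continuous_on {0<..<1} ?f"
  proof (rule continuous_on_cong[OF refl])
    fix t :: real assume t: "t \<in> {0<..<1}"
    hence "Re (p / of_real (t * (1 - t))) > 0" using Re_beta_argument(2)[of t] p by force
    thus "of_real t powr x * of_real (1 - t) powr y * (bessel_integral \<mu> (p / of_real (t * (1 - t))) / 2) = ?f t"
      by (simp only: bessel_K_eq_integral)
  qed
  finally have meas: "(\<lambda>t. indicator {0<..<1} t *\<^sub>R ?f t) \<in> borel_measurable borel"
    by (rule borel_measurable_continuous_on_indicator[rotated]) auto
  have "integrable lborel (\<lambda>t. indicator {0<..<1::real} t *\<^sub>R C)"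
    by simp
  thus ?thesis
    unfolding set_integrable_def
  proof (rule Bochner_Integration.integrable_bound)
    have "norm (indicator {0<..<1} t *\<^sub>R ?f t) \<le> norm (indicator {0<..<1} t *\<^sub>R C)" for t
      using bound[of t] by (auto simp: indicator_def simp del: of_real_mult of_real_diff)
    thus "AE t in lborel. norm (indicator {0<..<1} t *\<^sub>R ?f t) \<le> norm (indicator {0<..<1} t *\<^sub>R C)"
      by simp
  qed (use meas in simp)
qed

end

section \<open>Telescoping the geometric series under the integral\<close>

theorem theorem5:
  fixes x y \<nu> p :: complex
  assumes "Re p > 0"
  shows "(\<lambda>n. ext_Beta \<nu> (x + of_nat n) (y + 1) p) sums ext_Beta \<nu> x y p"
proof -
  define k where "k = (\<lambda>t. indicator {0<..<1::real} t *\<^sub>R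
    (of_real t powr (x - 3 / 2) * of_real (1 - t) powr (y - 3 / 2) *
     bessel_K (\<nu> + 1 / 2) (p / of_real (t * (1 - t)))))"
  have k: "integrable lborel k"
    using ext_Beta_integrand_integrable[OF assms] unfolding k_def set_integrable_def .
  \<comment> \<open>These are the partial sums of (1 - t) t^n over n < N. Their differences are the
    extra factors in the summands, and \<open>w 0 = 0\<close> makes the telescoping sum equal to
    \<open>w N\<close>.\<close>
  define w where "w = (\<lambda>N t::real. complex_of_real (1 - t ^ N))"
  have term_eq: "ext_Beta \<nu> (x + of_nat n) (y + 1) p =
      csqrt (2 * p / of_real pi) * (LBINT t. (w (Suc n) t - w n t) * k t)" for n
  proof -
    have "indicator {0<..<1::real} t *\<^sub>R
      (of_real t powr (x + of_nat n - 3 / 2) * of_real (1 - t) powr (y + 1 - 3 / 2) *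
       bessel_K (\<nu> + 1 / 2) (p / of_real (t * (1 - t)))) = (w (Suc n) t - w n t) * k t" for t
    proof (cases "t \<in> {0<..<1}")
      case True
      have "complex_of_real t powr (x + of_nat n - 3 / 2) = of_real t powr (x - 3 / 2) * of_real t ^ n"
        using True powr_add[of "of_real t" "x - 3 / 2" "of_nat n"] by (simp add: powr_nat algebra_simps)
      moreover have "complex_of_real (1 - t) powr (y + 1 - 3 / 2) = of_real (1 - t) powr (y - 3 / 2) * of_real (1 - t)"
        using True powr_add[of "of_real (1 - t)" "y - 3 / 2" 1] by (simp add: algebra_simps)
      moreover have "w (Suc n) t - w n t = of_real t ^ n * of_real (1 - t)"
        by (simp add: w_def algebra_simps)
      ultimately show ?thesis using True by (simp only: k_def mult_ac mult_scaleR_right)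
    qed (simp add: k_def)
    thus ?thesis by (simp add: ext_Beta_def set_lebesgue_integral_def)
  qed
  \<comment> \<open>On the unit interval the weights lie between 0 and 1; elsewhere \<open>k\<close>
    is 0. So \<open>k\<close> itself dominates every partial sum.\<close>
  have bound: "norm (w N t * k t) \<le> norm (k t)" for N t
  proof (cases "t \<in> {0<..<1}")
    case True
    hence "0 \<le> t ^ N" "t ^ N \<le> 1" by (auto intro: power_le_one)
    hence "norm (w N t) \<le> 1" unfolding w_def norm_of_real by simp
    thus ?thesis by (simp add: norm_mult mult_left_le_one_le)
  qed (simp add: k_def)
  have int: "integrable lborel (\<lambda>t. w N t * k t)" for N
  proof (rule Bochner_Integration.integrable_bound[OF k])
    show "(\<lambda>t. w N t * k t) \<in> borel_measurable lborel"
      using k unfolding w_def by measurable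
    show "AE t in lborel. norm (w N t * k t) \<le> norm (k t)" using bound by simp
  qed
  have "(\<Sum>n<N. ext_Beta \<nu> (x + of_nat n) (y + 1) p) =
      csqrt (2 * p / of_real pi) * (LBINT t. w N t * k t)" for N
  proof -
    have "(\<Sum>n<N. ext_Beta \<nu> (x + of_nat n) (y + 1) p) =
        csqrt (2 * p / of_real pi) * (\<Sum>n<N. (LBINT t. w (Suc n) t * k t) - (LBINT t. w n t * k t))"
      using int by (simp add: term_eq sum_distrib_left left_diff_distrib)
    also have "(\<Sum>n<N. (LBINT t. w (Suc n) t * k t) - (LBINT t. w n t * k t)) = (LBINT t. w N t * k t)"
      by (subst sum_lessThan_telescope) (simp add: w_def)
    finally show ?thesis .
  qed
  moreover have "(\<lambda>N. LBINT t. w N t * k t) \<longlonglongrightarrow> (LBINT t. k t)"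
  proof (rule integral_dominated_convergence)
    show "integrable lborel (\<lambda>t. norm (k t))" using k by simp
    have "(\<lambda>N. w N t * k t) \<longlonglongrightarrow> k t" for t
    proof (cases "t \<in> {0<..<1}")
      case True
      hence "(\<lambda>N. of_real (1 - t ^ N) * k t) \<longlonglongrightarrow> of_real (1 - 0) * k t"
        by (intro tendsto_intros LIMSEQ_realpow_zero) auto
      thus ?thesis by (simp add: w_def)
    qed (simp add: k_def)
    thus "AE t in lborel. (\<lambda>N. w N t * k t) \<longlonglongrightarrow> k t" by simp
  qed (use int k bound in auto)
  moreover have "ext_Beta \<nu> x y p = csqrt (2 * p / of_real pi) * (LBINT t. k t)"
    by (simp add: ext_Beta_def k_def set_lebesgue_integral_def)
  ultimately show ?thesis
    unfolding sums_def by (simp add: tendsto_mult_left)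
qed

end
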